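(* (Jensen's inequality.) Let $\mathbb{T}$ be a time scale, let $a,b\in\mathbb{T}$ with $a<b$, and let $c,d\in\mathbb{R}$ with $c<d$. Let $g\in C_{rd}([a,b]_{\mathbb{T}},(c,d))$ and $h\in C_{rd}([a,b]_{\mathbb{T}},\mathbb{R})$ with $\int_a^b|h(s)|\Delta s>0$. If $f\in C((c,d),\mathbb{R}^{+}_{\mathcal{I}})$ is a convex interval-valued function, then $$\frac{(IR)\int_a^b|h(s)|f(g(s))\Delta s}{\int_a^b|h(s)|\Delta s}\subseteq f\Bigg(\frac{\int_a^b|h(s)|g(s)\Delta s}{\int_a^b|h(s)|\Delta s}\Bigg).$$
   Context: A time scale $\mathbb{T}$ is a nonempty closed subset of $\mathbb{R}$. For $a,b\in\mathbb{T}$, $[a,b]_{\mathbb{T}}=\{t\in\mathbb{T}:a\le t\le b\}$ and $[a,b)_{\mathbb{T}}=\{t\in\mathbb{T}:a\le t<b\}$. Put $\sigma(t)=\inf\{s\in\mathbb{T}:s>t\}$ and $\rho(t)=\sup\{s\in\mathbb{T}:s<t\}$ (with $\sigma(\sup\mathbb{T})=\sup\mathbb{T}$, $\rho(\inf\mathbb{T})=\inf\mathbb{T}$ when finite). A point $t$ is right-dense if $\sigma(t)=t<\sup\mathbb{T}$ and left-dense if $\rho(t)=t>\inf\mathbb{T}$. $C_{rd}([a,b]_{\mathbb{T}},X)$, $X\subseteq\mathbb{R}$, is the set of $rd$-continuous functions $[a,b]_{\mathbb{T}}\to X$: right continuous at each right-dense point, with a finite left limit at each left-dense point. Here $(c,d)$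 is a real open interval. $\mathbb{R}_{\mathcal{I}}$ is the set of nonempty compact intervals $[\underline{u},\overline{u}]\subset\mathbb{R}$, $\underline{u}\le\overline{u}$ (degenerate intervals allowed); $\mathbb{R}^+_{\mathcal{I}}$ is the subset with $\underline{u}>0$. The metric is $d([\underline{u},\overline{u}],[\underline{v},\overline{v}])=\max\{|\underline{u}-\underline{v}|,|\overline{u}-\overline{v}|\}$; $C((c,d),\mathbb{R}^+_{\mathcal{I}})$ is the set of functions continuous for this metric. Operations: $[\underline{u},\overline{u}]+[\underline{v},\overline{v}]=[\underline{u}+\underline{v},\overline{u}+\overline{v}]$; $\lambda[\underline{u},\overline{u}]=[\lambda\underline{u},\lambda\overline{u}]$ for $\lambda>0$, and $0\cdot[\underline{u},\overline{u}]=\{0\}$; dividing by a positive real means multiplying by its reciprocal. $f:(c,d)\to\mathbb{R}_{\mathcal{I}}$ is a convex interval-valued function if $\alpha f(x)+(1-\alpha)f(y)\subseteq f(\alpha x+(1-\alpha)y)$ for all $x,y\in(c,d)$, $\alpha\in(0,1)$. A division of $[a,b]_{\mathbb{T}}$ is a finite set $D=\{a=t_0<\cdots<t_n=b\}\subseteq[a,b]_{\mathbb{T}}$. For $\delta>0$, $\mathcal{D}(\delta,[a,b]_{\mathbb{T}})$ is the (nonempty) set of divisions such that for each $i$ either $t_i-t_{i-1}\le\delta$, or $t_i-t_{i-1}>\delta$ and $\rho(t_i)=t_{i-1}$. A Riemann $\Delta$-sum of a function $F$ (with values in $\mathbb{R}$ or $\mathbb{R}_{\mathcal{I}}$) is $S(F,D,\delta)=\sum_{i=1}^nF(\xi_i)(t_i-t_{i-1})$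 with $D\in\mathcal{D}(\delta,[a,b]_{\mathbb{T}})$ and arbitrary $\xi_i\in[t_{i-1},t_i)_{\mathbb{T}}$. An interval-valued $F$ is $IR$ $\Delta$-integrable with integral $A=(IR)\int_a^bF(t)\Delta t\in\mathbb{R}_{\mathcal{I}}$ if for every $\epsilon>0$ there is $\delta>0$ with $d(S(F,D,\delta),A)<\epsilon$ for all $D\in\mathcal{D}(\delta,[a,b]_{\mathbb{T}})$ and all choices of $\xi_i$. The Riemann $\Delta$-integral $\int_a^bF(t)\Delta t$ of a real-valued $F$ is defined in the same way using $|S(F,D,\delta)-A|<\epsilon$. *)

theory Defs
  imports "HOL-Analysis.Analysis" "HOL-Library.Interval"
begin

section \<open>Time scales\<close>

definition time_scale :: "real set \<Rightarrow> bool" where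
  "time_scale T \<longleftrightarrow> T \<noteq> {} \<and> closed T"

definition ts_icc :: "real set \<Rightarrow> real \<Rightarrow> real \<Rightarrow> real set" where
  "ts_icc T a b = {t \<in> T. a \<le> t \<and> t \<le> b}"

definition ts_ico :: "real set \<Rightarrow> real \<Rightarrow> real \<Rightarrow> real set" where
  "ts_ico T a b = {t \<in> T. a \<le> t \<and> t < b}"

text \<open>For \<open>t \<in> T\<close>, the set below is empty exactly when \<open>t\<close> is the maximum (minimum) of
  \<open>T\<close>; the jump operators then return \<open>t\<close> itself.\<close>

definition forward_jump :: "real set \<Rightarrow> real \<Rightarrow> real" where
  "forward_jump T t = (if {s \<in> T. s > t} = {} then t else Inf {s \<in> T. s > t})"

definition backward_jump :: "real set \<Rightarrow> real \<Rightarrow> real" where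
  "backward_jump T t = (if {s \<in> T. s < t} = {} then t else Sup {s \<in> T. s < t})"

text \<open>\<open>\<exists>s\<in>T. t < s\<close> expresses \<open>t < sup T\<close>, where \<open>sup T\<close> may be infinite; likewise for \<open>inf T\<close>.\<close>

definition right_dense :: "real set \<Rightarrow> real \<Rightarrow> bool" where
  "right_dense T t \<longleftrightarrow> forward_jump T t = t \<and> (\<exists>s\<in>T. t < s)"

definition left_dense :: "real set \<Rightarrow> real \<Rightarrow> bool" where
  "left_dense T t \<longleftrightarrow> backward_jump T t = t \<and> (\<exists>s\<in>T. s < t)"

text \<open>Functions on \<open>[a,b]\<^sub>T\<close> are total functions whose values outside \<open>[a,b]\<^sub>T\<close> are irrelevant.
  The limits are taken inside \<open>[a,b]\<^sub>T\<close>, so they impose nothing from the right at \<open>b\<close> or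
  from the left at \<open>a\<close>.\<close>

definition C_rd :: "real set \<Rightarrow> real \<Rightarrow> real \<Rightarrow> real set \<Rightarrow> (real \<Rightarrow> real) set" where
  "C_rd T a b X = {g. (\<forall>t\<in>ts_icc T a b. g t \<in> X)
     \<and> (\<forall>t\<in>ts_icc T a b. right_dense T t \<longrightarrow>
          (g \<longlongrightarrow> g t) (at t within (ts_icc T a b \<inter> {t<..})))
     \<and> (\<forall>t\<in>ts_icc T a b. left_dense T t \<longrightarrow>
          (\<exists>l. (g \<longlongrightarrow> l) (at t within (ts_icc T a b \<inter> {..<t}))))}"


section \<open>Compact intervals\<close>

definition pos_intervals :: "real interval set" where
  "pos_intervals = {X. 0 < lower X}"

definition ivl_dist :: "real interval \<Rightarrow> real interval \<Rightarrow> real" where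
  "ivl_dist X Y = max \<bar>lower X - lower Y\<bar> \<bar>upper X - upper Y\<bar>"

definition ivl_scale :: "real \<Rightarrow> real interval \<Rightarrow> real interval" where
  "ivl_scale r X = interval_of r * X"

lemma lower_ivl_scale: "0 \<le> r \<Longrightarrow> lower (ivl_scale r X) = r * lower X"
  by (simp add: ivl_scale_def lower_times min_absorb1 mult_left_mono)

lemma upper_ivl_scale: "0 \<le> r \<Longrightarrow> upper (ivl_scale r X) = r * upper X"
  by (simp add: ivl_scale_def upper_times max_absorb2 mult_left_mono)

text \<open>Continuity is stated with \<open>ivl_dist\<close> because the \<open>topological_space\<close> instance of
  \<open>interval\<close> is not provably the topology of this metric: its open sets are described by
  \<open>Interval ` (A \<times> B)\<close>, which also applies the underspecified abstraction function to pairs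
  with decreasing endpoints.\<close>

definition C_ivl :: "real set \<Rightarrow> real interval set \<Rightarrow> (real \<Rightarrow> real interval) set" where
  "C_ivl S Y = {f. (\<forall>x\<in>S. f x \<in> Y)
     \<and> (\<forall>x\<in>S. \<forall>e>0. \<exists>r>0. \<forall>y\<in>S. \<bar>y - x\<bar> < r \<longrightarrow> ivl_dist (f y) (f x) < e)}"

definition convex_ivl_on :: "real set \<Rightarrow> (real \<Rightarrow> real interval) \<Rightarrow> bool" where
  "convex_ivl_on S f \<longleftrightarrow> (\<forall>x\<in>S. \<forall>y\<in>S. \<forall>\<alpha>\<in>{0<..<1}.
     set_of (ivl_scale \<alpha> (f x) + ivl_scale (1 - \<alpha>) (f y)) \<subseteq> set_of (f (\<alpha> * x + (1 - \<alpha>) * y)))"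


section \<open>Riemann delta integrals\<close>

text \<open>A division \<open>{a = t\<^sub>0 < \<dots> < t\<^sub>n = b}\<close> is given by \<open>n\<close> and the values of \<open>t\<close> on \<open>{0..n}\<close>,
  its tags by the values of \<open>\<xi>\<close> on \<open>{1..n}\<close>.\<close>

definition fine_division ::
    "real set \<Rightarrow> real \<Rightarrow> real \<Rightarrow> real \<Rightarrow> nat \<Rightarrow> (nat \<Rightarrow> real) \<Rightarrow> bool" where
  "fine_division T a b \<delta> n t \<longleftrightarrow>
     t 0 = a \<and> t n = b \<and> (\<forall>i\<in>{0..n}. t i \<in> ts_icc T a b)
     \<and> (\<forall>i\<in>{1..n}. t (i - 1) < t i)
     \<and> (\<forall>i\<in>{1..n}. t i - t (i - 1) \<le> \<delta>
          \<or> t i - t (i - 1) > \<delta> \<and> backward_jump T (t i) = t (i - 1))"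

definition tags_of :: "real set \<Rightarrow> nat \<Rightarrow> (nat \<Rightarrow> real) \<Rightarrow> (nat \<Rightarrow> real) \<Rightarrow> bool" where
  "tags_of T n t \<xi> \<longleftrightarrow> (\<forall>i\<in>{1..n}. \<xi> i \<in> ts_ico T (t (i - 1)) (t i))"

definition delta_sum :: "(real \<Rightarrow> real) \<Rightarrow> nat \<Rightarrow> (nat \<Rightarrow> real) \<Rightarrow> (nat \<Rightarrow> real) \<Rightarrow> real" where
  "delta_sum F n t \<xi> = (\<Sum>i=1..n. F (\<xi> i) * (t i - t (i - 1)))"

definition ivl_delta_sum ::
    "(real \<Rightarrow> real interval) \<Rightarrow> nat \<Rightarrow> (nat \<Rightarrow> real) \<Rightarrow> (nat \<Rightarrow> real) \<Rightarrow> real interval" where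
  "ivl_delta_sum F n t \<xi> = (\<Sum>i=1..n. ivl_scale (t i - t (i - 1)) (F (\<xi> i)))"

definition has_delta_integral ::
    "real set \<Rightarrow> real \<Rightarrow> real \<Rightarrow> (real \<Rightarrow> real) \<Rightarrow> real \<Rightarrow> bool" where
  "has_delta_integral T a b F A \<longleftrightarrow>
     (\<forall>\<epsilon>>0. \<exists>\<delta>>0. \<forall>n t \<xi>. fine_division T a b \<delta> n t \<and> tags_of T n t \<xi> \<longrightarrow>
        \<bar>delta_sum F n t \<xi> - A\<bar> < \<epsilon>)"

definition has_IR_delta_integral ::
    "real set \<Rightarrow> real \<Rightarrow> real \<Rightarrow> (real \<Rightarrow> real interval) \<Rightarrow> real interval \<Rightarrow> bool" where
  "has_IR_delta_integral T a b F A \<longleftrightarrow>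
     (\<forall>\<epsilon>>0. \<exists>\<delta>>0. \<forall>n t \<xi>. fine_division T a b \<delta> n t \<and> tags_of T n t \<xi> \<longrightarrow>
        ivl_dist (ivl_delta_sum F n t \<xi>) A < \<epsilon>)"

definition delta_integrable :: "real set \<Rightarrow> real \<Rightarrow> real \<Rightarrow> (real \<Rightarrow> real) \<Rightarrow> bool" where
  "delta_integrable T a b F \<longleftrightarrow> (\<exists>A. has_delta_integral T a b F A)"

definition IR_delta_integrable :: "real set \<Rightarrow> real \<Rightarrow> real \<Rightarrow> (real \<Rightarrow> real interval) \<Rightarrow> bool" where
  "IR_delta_integrable T a b F \<longleftrightarrow> (\<exists>A. has_IR_delta_integral T a b F A)"

definition delta_integral :: "real set \<Rightarrow> real \<Rightarrow> real \<Rightarrow> (real \<Rightarrow> real) \<Rightarrow> real" where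
  "delta_integral T a b F = (THE A. has_delta_integral T a b F A)"

definition IR_delta_integral ::
    "real set \<Rightarrow> real \<Rightarrow> real \<Rightarrow> (real \<Rightarrow> real interval) \<Rightarrow> real interval" where
  "IR_delta_integral T a b F = (THE A. has_IR_delta_integral T a b F A)"

end

theory Submission
  imports Defs
begin

text \<open>Jensen's inequality for an interval-valued \<open>f\<close> is a pair of scalar inequalities. Inclusion of
  intervals reverses the order of lower endpoints and preserves that of upper endpoints, so
  convexity of \<open>f\<close> says that \<open>x \<mapsto> lower (f x)\<close> is convex and \<open>x \<mapsto> upper (f x)\<close> is concave
  (\<open>convex_ivl_on_endpoints\<close>), and the IR integral is formed endpoint by endpoint
  (\<open>has_IR_delta_integral_iff\<close>). For a scalar convex \<open>\<phi>\<close> and the weighted mean \<open>m\<close> of \<open>g\<close> one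
  integrates the supporting line \<open>\<phi> m + k (g - m) \<le> \<phi> (g)\<close> against \<open>\<bar>h\<bar>\<close>; the linear term
  vanishes (\<open>delta_integral_jensen\<close>).

  What remains is to know that every integrand is integrable. The tool is the step extension
  \<open>y \<mapsto> F (ts_floor T a b y)\<close>, which freezes \<open>F\<close> on each gap of the time scale at its value at
  the left end of the gap. For rd-continuous \<open>F\<close> the extension is right-continuous with left
  limits on the whole line, hence uniformly close to step functions on \<open>{a..b}\<close>, and the Riemann
  delta-sums of \<open>F\<close> converge to its ordinary integral (\<open>delta_sum_error\<close>). Linearity, monotonicity and
  strict positivity of delta integrals are then read off from ordinary integrals. Since fine
  divisions exist (\<open>fine_division_exists\<close>), a delta integral is unique, so the definite
  descriptions denote the values found.

  Two points concern the ends of \<open>{c<..<d}\<close>. The function \<open>g\<close> may tend to \<open>c\<close> or \<open>d\<close> at a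
  left-dense point, outside the domain of \<open>f\<close>; \<open>f \<circ> g\<close> still has a left limit there because a
  convex function that is bounded above near an endpoint of its domain has a limit at it
  (\<open>convex_on_tendsto_at_right\<close>). Positivity of \<open>f\<close> provides the bound: \<open>- upper\<close> is convex and
  negative, and then \<open>lower \<le> upper\<close> is bounded above near the ends. And the mean \<open>m\<close> lies
  strictly between \<open>c\<close> and \<open>d\<close> because the integral of \<open>\<bar>h\<bar>\<close> times a positive rd-continuous
  function is positive (\<open>weighted_delta_integral_pos\<close>).\<close>

section \<open>Right-continuous functions with left limits\<close>

definition right_cont_left_lim :: "(real \<Rightarrow> real) \<Rightarrow> bool" where
  "right_cont_left_lim G \<longleftrightarrow> (\<forall>x. (G \<longlongrightarrow> G x) (at_right x)) \<and> (\<forall>x. \<exists>l. (G \<longlongrightarrow> l) (at_left x))"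

text \<open>The set \<open>X\<close> holds the jump points of \<open>g\<close>. The interval \<open>{s<..s'}\<close> is half-open because a
  right-continuous step function that jumps at \<open>s\<close> keeps the value \<open>g s\<close> until its next jump.\<close>

definition step_approx ::
    "(real \<Rightarrow> real) \<Rightarrow> real \<Rightarrow> real \<Rightarrow> real \<Rightarrow> (real \<Rightarrow> real) \<Rightarrow> real set \<Rightarrow> bool" where
  "step_approx G e u v g X \<longleftrightarrow> finite X \<and> g integrable_on {u..v} \<and> bounded (g ` {u..v})
     \<and> (\<forall>y\<in>{u..v}. \<bar>G y - g y\<bar> \<le> e)
     \<and> (\<forall>s\<in>{u..v}. \<forall>s'\<in>{u..v}. s \<le> s' \<longrightarrow> X \<inter> {s<..s'} = {} \<longrightarrow> g s = g s')"

text \<open>Used as a rewrite rule, the last clause of \<open>step_approx\<close> would loop; the destruction rules keep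
  it away from the simplifier.\<close>

lemma step_approxD:
  assumes "step_approx G e u v g X"
  shows "finite X" "g integrable_on {u..v}" "bounded (g ` {u..v})"
    and "y \<in> {u..v} \<Longrightarrow> \<bar>G y - g y\<bar> \<le> e"
    and "u \<le> s \<Longrightarrow> s \<le> s' \<Longrightarrow> s' \<le> v \<Longrightarrow> X \<inter> {s<..s'} = {} \<Longrightarrow> g s = g s'"
proof -
  show "g s = g s'" if "u \<le> s" "s \<le> s'" "s' \<le> v" "X \<inter> {s<..s'} = {}"
  proof -
    have "s \<in> {u..v}" "s' \<in> {u..v}" using that by auto
    then show ?thesis using assms that(2,4) unfolding step_approx_def by blast
  qed
qed (use assms in \<open>unfold step_approx_def, blast+\<close>)

lemma integrable_on_glue:
  fixes g1 g2 :: "real \<Rightarrow> real"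
  assumes "g1 integrable_on {u..v}" "g2 integrable_on {v..w}" "u \<le> v" "v \<le> w"
  shows "(\<lambda>y. if y < v then g1 y else g2 y) integrable_on {u..w}"
proof (rule Henstock_Kurzweil_Integration.integrable_combine[OF assms(3,4)])
  show "(\<lambda>y. if y < v then g1 y else g2 y) integrable_on {u..v}"
    by (rule integrable_spike_finite[OF _ _ assms(1), of "{v}"]) auto
  show "(\<lambda>y. if y < v then g1 y else g2 y) integrable_on {v..w}"
    by (rule integrable_spike_finite[OF _ _ assms(2), of "{}"]) auto
qed

lemma step_approx_glue:
  assumes "step_approx G e u v g1 X1" "step_approx G e v w g2 X2" "u \<le> v" "v \<le> w"
  shows "step_approx G e u w (\<lambda>y. if y < v then g1 y else g2 y) (X1 \<union> X2 \<union> {v})"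
proof -
  let ?g = "\<lambda>y. if y < v then g1 y else g2 y"
  have "bounded (g1 ` {u..v} \<union> g2 ` {v..w})"
    using step_approxD(3)[OF assms(1)] step_approxD(3)[OF assms(2)] by simp
  then have "bounded (?g ` {u..w})"
    by (rule bounded_subset) auto
  moreover have "?g integrable_on {u..w}"
    by (rule integrable_on_glue[OF step_approxD(2)[OF assms(1)] step_approxD(2)[OF assms(2)] assms(3,4)])
  moreover have "?g s = ?g s'"
    if "s \<in> {u..w}" "s' \<in> {u..w}" "s \<le> s'" "(X1 \<union> X2 \<union> {v}) \<inter> {s<..s'} = {}" for s s'
  proof -
    from that have *: "X1 \<inter> {s<..s'} = {}" "X2 \<inter> {s<..s'} = {}" "\<not> (s < v \<and> v \<le> s')"
      by auto
    show ?thesis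
    proof (cases "s' < v")
      case True
      then show ?thesis using step_approxD(5)[OF assms(1), of s s'] that * by simp
    next
      case False
      then show ?thesis using step_approxD(5)[OF assms(2), of s s'] that * by simp
    qed
  qed
  moreover have "\<bar>G y - ?g y\<bar> \<le> e" if "y \<in> {u..w}" for y
    using step_approxD(4)[OF assms(1), of y] step_approxD(4)[OF assms(2), of y] that by auto
  moreover have "finite (X1 \<union> X2 \<union> {v})"
    using step_approxD(1)[OF assms(1)] step_approxD(1)[OF assms(2)] by simp
  ultimately show ?thesis
    unfolding step_approx_def by blast
qed

text \<open>Near a point \<open>x\<close>, the two-valued function that takes the left limit at \<open>x\<close> before \<open>x\<close> and
  \<open>G x\<close> from \<open>x\<close> on is a good approximation; bisection glues finitely many of these together.\<close>

lemma step_approx_exists: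
  assumes G: "right_cont_left_lim G" and "a \<le> b" "0 < e"
  obtains g X where "step_approx G e a b g X"
proof -
  have "\<exists>g X. step_approx G e a b g X"
    using \<open>a \<le> b\<close>
  proof (induction rule: Bolzano)
    case (trans u v w)
    then show ?case using step_approx_glue by blast
  next
    case (local x)
    obtain l where l: "(G \<longlongrightarrow> l) (at_left x)"
      using G unfolding right_cont_left_lim_def by blast
    have r: "(G \<longlongrightarrow> G x) (at_right x)"
      using G unfolding right_cont_left_lim_def by blast
    from tendstoD[OF l \<open>0 < e\<close>] obtain p where p: "p < x" "\<And>y. p < y \<Longrightarrow> y < x \<Longrightarrow> dist (G y) l < e"
      by (auto simp: eventually_at_left_field)
    from tendstoD[OF r \<open>0 < e\<close>] obtain q where q: "x < q" "\<And>y. x < y \<Longrightarrow> y < q \<Longrightarrow> dist (G y) (G x) < e"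
      by (auto simp: eventually_at_right_field)
    let ?g = "\<lambda>y. if y < x then l else G x"
    have "step_approx G e u v ?g {x}" if "u \<le> x" "x \<le> v" "v - u < min (x - p) (q - x)" for u v
    proof -
      have "bounded (?g ` {u..v})"
        by (rule bounded_subset[of "{l, G x}"]) auto
      moreover have "?g integrable_on {u..v}"
        using that by (intro integrable_on_glue) auto
      moreover have "\<bar>G y - ?g y\<bar> \<le> e" if "y \<in> {u..v}" for y
        using p(2)[of y] q(2)[of y] that \<open>u \<le> x\<close> \<open>x \<le> v\<close> \<open>v - u < min (x - p) (q - x)\<close> \<open>0 < e\<close>
        by (cases "y = x") (auto simp: dist_real_def)
      moreover have "?g s = ?g s'" if "s \<le> s'" "{x} \<inter> {s<..s'} = {}" for s s'
        using that by auto
      ultimately show ?thesis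
        unfolding step_approx_def by blast
    qed
    moreover have "0 < min (x - p) (q - x)" using p q by auto
    ultimately show ?case by blast
  qed
  then show ?thesis using that by blast
qed

lemma right_cont_left_lim_integrable:
  assumes "right_cont_left_lim G"
  shows "G integrable_on {u..v}"
proof (cases "u \<le> v")
  case True
  have "G integrable_on cbox u v"
  proof (rule integrable_uniform_limit)
    fix e :: real assume "0 < e"
    then obtain g X where "step_approx G e u v g X"
      using step_approx_exists[OF assms True] by blast
    then show "\<exists>g. (\<forall>x\<in>cbox u v. norm (G x - g x) \<le> e) \<and> g integrable_on cbox u v"
      using step_approxD(2,4) by fastforce
  qed
  then show ?thesis by simp
next
  case False
  then show ?thesis by (simp add: integrable_on_empty)
qed

lemma right_cont_left_lim_bounded:
  assumes "right_cont_left_lim G"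
  obtains M where "0 \<le> M" "\<And>y. y \<in> {u..v} \<Longrightarrow> \<bar>G y\<bar> \<le> M"
proof (cases "u \<le> v")
  case True
  obtain g X where g: "step_approx G 1 u v g X"
    using step_approx_exists[OF assms True, of 1] by auto
  obtain N where N: "\<And>y. y \<in> {u..v} \<Longrightarrow> \<bar>g y\<bar> \<le> N"
    using step_approxD(3)[OF g] unfolding bounded_iff real_norm_def by blast
  have "\<bar>G y\<bar> \<le> \<bar>N\<bar> + 1" if "y \<in> {u..v}" for y
  proof -
    have "\<bar>G y - g y\<bar> \<le> 1" by (rule step_approxD(4)[OF g that])
    then show ?thesis using N[OF that] by linarith
  qed
  then show ?thesis using that[of "\<bar>N\<bar> + 1"] by auto
next
  case False
  then show ?thesis using that[of 0] by auto
qed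

text \<open>Right-continuity keeps \<open>G\<close> above \<open>G t / 2\<close> on an interval of positive length to the right of
  \<open>t\<close>, inside \<open>{a..b}\<close> because \<open>t < b\<close>.\<close>

lemma integral_pos_if_right_cont:
  assumes G: "right_cont_left_lim G" and nonneg: "\<And>y. y \<in> {a..b} \<Longrightarrow> 0 \<le> G y"
    and t: "a \<le> t" "t < b" "0 < G t"
  shows "0 < integral {a..b} G"
proof -
  have "(G \<longlongrightarrow> G t) (at_right t)"
    using G unfolding right_cont_left_lim_def by blast
  from tendstoD[OF this, of "G t / 2"] t obtain q
    where q: "t < q" "\<And>y. t < y \<Longrightarrow> y < q \<Longrightarrow> dist (G y) (G t) < G t / 2"
    by (auto simp: eventually_at_right_field)
  define r where "r = (t + min q b) / 2"
  have r: "t < r" "r < q" "r < b" using q t by (auto simp: r_def min_def)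
  have "0 < (r - t) * (G t / 2)" using r t by simp
  also have "\<dots> = integral {t..r} (\<lambda>_. G t / 2)" using r by simp
  also have "\<dots> \<le> integral {t..r} G"
  proof (rule integral_le)
    fix y assume "y \<in> {t..r}"
    then show "G t / 2 \<le> G y"
      using q(2)[of y] r t by (cases "y = t") (auto simp: dist_real_def abs_if split: if_splits)
  qed (auto intro: right_cont_left_lim_integrable[OF G])
  also have "\<dots> \<le> integral {a..b} G"
    using r t nonneg
    by (intro integral_subset_le) (auto intro: right_cont_left_lim_integrable[OF G])
  finally show ?thesis .
qed

section \<open>Limits of convex functions at the ends of an open interval\<close>

text \<open>The slope of the chord from \<open>x\<close> to a fixed point \<open>z\<close> decreases as \<open>x\<close> moves down to \<open>c\<close>, and
  an upper bound on \<open>\<phi>\<close> near \<open>c\<close> is a lower bound on that slope. So the slope converges, and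
  \<open>\<phi>\<close> with it.\<close>

lemma convex_on_tendsto_at_right:
  fixes \<phi> :: "real \<Rightarrow> real"
  assumes conv: "convex_on {c<..<d} \<phi>" and "c < d"
    and bnd: "eventually (\<lambda>x. \<phi> x \<le> M) (at_right c)"
  shows "\<exists>l. (\<phi> \<longlongrightarrow> l) (at_right c)"
proof -
  obtain q where q: "c < q" "\<And>x. c < x \<Longrightarrow> x < q \<Longrightarrow> \<phi> x \<le> M"
    using bnd by (auto simp: eventually_at_right_field)
  define z where "z = (c + min q d) / 2"
  have z: "c < z" "z < q" "z < d" using q \<open>c < d\<close> by (auto simp: z_def min_def)
  define w where "w = (c + z) / 2"
  have w: "c < w" "w < z" using z by (auto simp: w_def)
  define \<psi> where "\<psi> x = (\<phi> x - \<phi> z) / (x - z)" for x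
  have mono: "\<psi> x \<le> \<psi> y" if "c < x" "x \<le> y" "y < z" for x y
    using convex_on_slope_le(2)[OF conv, of x z y] that z
    by (cases "x = y") (auto simp: \<psi>_def)
  define N where "N = (M - \<phi> z) / (z - w)"
  have below: "- N \<le> \<psi> x" if "c < x" "x < w" for x
  proof -
    have "\<psi> x = - ((\<phi> x - \<phi> z) / (z - x))"
      unfolding \<psi>_def by (metis minus_diff_eq minus_divide_right)
    moreover have "(\<phi> x - \<phi> z) / (z - x) \<le> (M - \<phi> z) / (z - w)"
      using that w z q(2)[of x] q(2)[of z] by (intro frac_le) auto
    ultimately show ?thesis by (simp add: N_def)
  qed
  define l where "l = Inf (\<psi> ` {c<..<w})"
  have bdd: "bdd_below (\<psi> ` {c<..<w})"
    using below by (intro bdd_belowI2[of _ "- N"]) auto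
  have "(\<psi> \<longlongrightarrow> l) (at_right c)"
  proof (rule decreasing_tendsto)
    show "\<forall>\<^sub>F x in at_right c. l \<le> \<psi> x"
      unfolding eventually_at_right_field l_def
      using w bdd by (intro exI[of _ w]) (auto intro!: cInf_lower)
  next
    fix y assume "l < y"
    then obtain x where x: "c < x" "x < w" "\<psi> x < y"
      unfolding l_def using cInf_lessD[of "\<psi> ` {c<..<w}" y] w by fastforce
    show "\<forall>\<^sub>F x in at_right c. \<psi> x < y"
      unfolding eventually_at_right_field
    proof (intro exI[of _ x] conjI allI impI)
      fix s assume "c < s" "s < x"
      then show "\<psi> s < y" using mono[of s x] x w by linarith
    qed (use x in auto)
  qed
  then have "((\<lambda>x. \<phi> z + \<psi> x * (x - z)) \<longlongrightarrow> \<phi> z + l * (c - z)) (at_right c)"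
    by (intro tendsto_intros)
  moreover have "\<forall>\<^sub>F x in at_right c. \<phi> z + \<psi> x * (x - z) = \<phi> x"
    unfolding eventually_at_right_field
    using z by (intro exI[of _ z]) (auto simp: \<psi>_def)
  ultimately show ?thesis
    using Lim_transform_eventually by blast
qed

lemma convex_on_tendsto_at_left:
  fixes \<phi> :: "real \<Rightarrow> real"
  assumes conv: "convex_on {c<..<d} \<phi>" and "c < d"
    and bnd: "eventually (\<lambda>x. \<phi> x \<le> M) (at_left d)"
  shows "\<exists>l. (\<phi> \<longlongrightarrow> l) (at_left d)"
proof -
  have "convex_on {-d<..<-c} (\<lambda>x. \<phi> (- x))"
  proof (rule convex_onI)
    fix t x y :: real assume "0 < t" "t < 1" "x \<in> {-d<..<-c}" "y \<in> {-d<..<-c}"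
    then have "\<phi> ((1 - t) *\<^sub>R (- x) + t *\<^sub>R (- y)) \<le> (1 - t) * \<phi> (- x) + t * \<phi> (- y)"
      by (intro convex_onD[OF conv]) auto
    then show "\<phi> (- ((1 - t) *\<^sub>R x + t *\<^sub>R y)) \<le> (1 - t) * \<phi> (- x) + t * \<phi> (- y)"
      by (simp add: algebra_simps)
  qed (rule convex_real_interval)
  then show ?thesis
    using convex_on_tendsto_at_right[of "-d" "-c" "\<lambda>x. \<phi> (- x)" M] bnd \<open>c < d\<close>
    by (simp add: filterlim_at_left_to_right eventually_at_left_to_right)
qed

section \<open>Operations on rd-continuous functions\<close>

lemma C_rd_binop:
  assumes u: "u \<in> C_rd T a b X" and v: "v \<in> C_rd T a b Y"
    and op: "\<And>F x y. (u \<longlongrightarrow> x) F \<Longrightarrow> (v \<longlongrightarrow> y) F \<Longrightarrow> ((\<lambda>t. op (u t) (v t)) \<longlongrightarrow> op x y) F"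
  shows "(\<lambda>t. op (u t) (v t)) \<in> C_rd T a b UNIV"
proof -
  have "((\<lambda>t. op (u t) (v t)) \<longlongrightarrow> op (u t) (v t)) (at t within (ts_icc T a b \<inter> {t<..}))"
    if "t \<in> ts_icc T a b" "right_dense T t" for t
    using u v that unfolding C_rd_def by (intro op) blast+
  moreover have "\<exists>l. ((\<lambda>t. op (u t) (v t)) \<longlongrightarrow> l) (at t within (ts_icc T a b \<inter> {..<t}))"
    if t: "t \<in> ts_icc T a b" "left_dense T t" for t
  proof -
    obtain x where "(u \<longlongrightarrow> x) (at t within (ts_icc T a b \<inter> {..<t}))"
      using u t unfolding C_rd_def by blast
    moreover obtain y where "(v \<longlongrightarrow> y) (at t within (ts_icc T a b \<inter> {..<t}))"
      using v t unfolding C_rd_def by blast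
    ultimately show ?thesis using op by blast
  qed
  ultimately show ?thesis unfolding C_rd_def by blast
qed

lemma C_rd_mult:
  "u \<in> C_rd T a b X \<Longrightarrow> v \<in> C_rd T a b Y \<Longrightarrow> (\<lambda>t. u t * v t) \<in> C_rd T a b UNIV"
  by (erule C_rd_binop) (auto intro: tendsto_mult)

lemma C_rd_abs: "u \<in> C_rd T a b X \<Longrightarrow> (\<lambda>t. \<bar>u t\<bar>) \<in> C_rd T a b UNIV"
  by (rule C_rd_binop[where op = "\<lambda>x y. \<bar>x\<bar>"]) (auto intro: tendsto_rabs)

lemma C_rd_affine: "u \<in> C_rd T a b X \<Longrightarrow> (\<lambda>t. p + q * u t) \<in> C_rd T a b UNIV"
  by (rule C_rd_binop[where op = "\<lambda>x y. p + q * x"]) (auto intro!: tendsto_intros)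

text \<open>At a left-dense point the left limit of \<open>g\<close> lies in \<open>{c..d}\<close>. If it is interior, continuity
  of \<open>\<phi>\<close> applies; if it is \<open>c\<close> or \<open>d\<close>, then \<open>g\<close> approaches it from inside the interval and the
  one-sided limit of \<open>\<phi>\<close> takes over.\<close>

lemma C_rd_compose:
  assumes g: "g \<in> C_rd T a b {c<..<d}" and cont: "continuous_on {c<..<d} \<phi>"
    and lim_c: "\<exists>l. (\<phi> \<longlongrightarrow> l) (at_right c)" and lim_d: "\<exists>l. (\<phi> \<longlongrightarrow> l) (at_left d)"
  shows "(\<lambda>t. \<phi> (g t)) \<in> C_rd T a b UNIV"
proof -
  let ?K = "ts_icc T a b"
  have g_in: "c < g t" "g t < d" if "t \<in> ?K" for t
    using g that unfolding C_rd_def by auto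
  have isCont: "isCont \<phi> x" if "c < x" "x < d" for x
    using cont that by (simp add: continuous_on_eq_continuous_at)
  have "((\<lambda>t. \<phi> (g t)) \<longlongrightarrow> \<phi> (g t)) (at t within (?K \<inter> {t<..}))"
    if t: "t \<in> ?K" "right_dense T t" for t
  proof -
    have "(g \<longlongrightarrow> g t) (at t within (?K \<inter> {t<..}))"
      using g t unfolding C_rd_def by blast
    then show ?thesis
      using isCont_tendsto_compose[OF isCont[OF g_in[OF t(1)]]] by blast
  qed
  moreover have "\<exists>l. ((\<lambda>t. \<phi> (g t)) \<longlongrightarrow> l) (at t within (?K \<inter> {..<t}))"
    if t: "t \<in> ?K" "left_dense T t" for t
  proof (cases "at t within (?K \<inter> {..<t}) = bot")
    case False
    obtain l where l: "(g \<longlongrightarrow> l) (at t within (?K \<inter> {..<t}))"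
      using g t unfolding C_rd_def by blast
    have ev: "\<forall>\<^sub>F s in at t within (?K \<inter> {..<t}). c < g s \<and> g s < d"
      unfolding eventually_at_filter using g_in by (auto intro!: always_eventually)
    have "c \<le> l"
      by (rule tendsto_lowerbound[OF l _ False]) (use ev in \<open>auto elim: eventually_mono\<close>)
    moreover have "l \<le> d"
      by (rule tendsto_upperbound[OF l _ False]) (use ev in \<open>auto elim: eventually_mono\<close>)
    ultimately consider "l = c" | "l = d" | "c < l" "l < d" by linarith
    then show ?thesis
    proof cases
      case 1
      then have "filterlim g (at_right c) (at t within (?K \<inter> {..<t}))"
        unfolding filterlim_at using l ev by (auto elim: eventually_mono)
      then show ?thesis using lim_c filterlim_compose by blast
    next
      case 2
      then have "filterlim g (at_left d) (at t within (?K \<inter> {..<t}))"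
        unfolding filterlim_at using l ev by (auto elim: eventually_mono)
      then show ?thesis using lim_d filterlim_compose by blast
    next
      case 3
      then show ?thesis using isCont_tendsto_compose[OF isCont l] by blast
    qed
  qed simp
  ultimately show ?thesis
    unfolding C_rd_def by blast
qed

section \<open>Fine divisions and the backward jump\<close>

lemma fine_division_mono:
  assumes "fine_division T a b \<delta> n t" "\<delta> \<le> \<delta>'"
  shows "fine_division T a b \<delta>' n t"
proof -
  have "t i - t (i - 1) \<le> \<delta>' \<or> t i - t (i - 1) > \<delta>' \<and> backward_jump T (t i) = t (i - 1)"
    if "i \<in> {1..n}" for i
  proof -
    have "t i - t (i - 1) \<le> \<delta> \<or> backward_jump T (t i) = t (i - 1)"
      using assms(1) that unfolding fine_division_def by blast
    then show ?thesis using assms(2) by linarith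
  qed
  then show ?thesis using assms(1) unfolding fine_division_def by blast
qed

lemma backward_jumpD:
  assumes "backward_jump T q = p" "p < q" "s \<in> T" "s < q"
  shows "s \<le> p"
proof -
  have "Sup {s \<in> T. s < q} = p"
    using assms unfolding backward_jump_def by (auto split: if_splits)
  moreover have "s \<le> Sup {s \<in> T. s < q}"
    using assms by (intro cSup_upper bdd_aboveI[of _ q]) auto
  ultimately show ?thesis by simp
qed

lemma backward_jumpI:
  assumes "p \<in> T" "p < q" "\<And>s. s \<in> T \<Longrightarrow> s < q \<Longrightarrow> s \<le> p"
  shows "backward_jump T q = p"
proof -
  have "Sup {s \<in> T. s < q} = p" using assms by (intro cSup_eq_maximum) auto
  then show ?thesis using assms by (auto simp: backward_jump_def)
qed

section \<open>Endpoints of interval-valued functions\<close>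

lemma lower_sum_interval: "lower (sum F S) = (\<Sum>i\<in>S. lower (F i))"
  for F :: "'a \<Rightarrow> real interval"
  by (induction S rule: infinite_finite_induct) auto

lemma upper_sum_interval: "upper (sum F S) = (\<Sum>i\<in>S. upper (F i))"
  for F :: "'a \<Rightarrow> real interval"
  by (induction S rule: infinite_finite_induct) auto

text \<open>The lengths \<open>t i - t (i - 1)\<close> are nonnegative, so scaling by them does not exchange endpoints
  and the interval sum splits into two real sums with the same division and tags.\<close>

lemma ivl_dist_ivl_delta_sum:
  assumes "fine_division T a b \<delta> n t"
  shows "ivl_dist (ivl_delta_sum F n t \<xi>) A =
    max \<bar>delta_sum (\<lambda>s. lower (F s)) n t \<xi> - lower A\<bar> \<bar>delta_sum (\<lambda>s. upper (F s)) n t \<xi> - upper A\<bar>"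
proof -
  have w: "0 \<le> t i - t (i - 1)" if "i \<in> {1..n}" for i
  proof -
    have "t (i - 1) < t i" using assms that unfolding fine_division_def by blast
    then show ?thesis by simp
  qed
  have "lower (ivl_delta_sum F n t \<xi>) = delta_sum (\<lambda>s. lower (F s)) n t \<xi>"
    unfolding ivl_delta_sum_def delta_sum_def lower_sum_interval
    by (intro sum.cong refl) (simp only: lower_ivl_scale[OF w] mult.commute)
  moreover have "upper (ivl_delta_sum F n t \<xi>) = delta_sum (\<lambda>s. upper (F s)) n t \<xi>"
    unfolding ivl_delta_sum_def delta_sum_def upper_sum_interval
    by (intro sum.cong refl) (simp only: upper_ivl_scale[OF w] mult.commute)
  ultimately show ?thesis by (simp add: ivl_dist_def)
qed

lemma has_IR_delta_integral_iff:
  "has_IR_delta_integral T a b F A \<longleftrightarrow>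
    has_delta_integral T a b (\<lambda>s. lower (F s)) (lower A) \<and>
    has_delta_integral T a b (\<lambda>s. upper (F s)) (upper A)" (is "?IR \<longleftrightarrow> ?L \<and> ?U")
proof
  assume IR: ?IR
  {
    fix \<epsilon> :: real assume "0 < \<epsilon>"
    obtain \<delta> where \<delta>: "0 < \<delta>" and "\<forall>n t \<xi>. fine_division T a b \<delta> n t \<and> tags_of T n t \<xi> \<longrightarrow>
        ivl_dist (ivl_delta_sum F n t \<xi>) A < \<epsilon>"
      using IR[unfolded has_IR_delta_integral_def, rule_format, OF \<open>0 < \<epsilon>\<close>] by auto
    then have close: "\<bar>delta_sum (\<lambda>s. lower (F s)) n t \<xi> - lower A\<bar> < \<epsilon>"
        "\<bar>delta_sum (\<lambda>s. upper (F s)) n t \<xi> - upper A\<bar> < \<epsilon>"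
      if "fine_division T a b \<delta> n t" "tags_of T n t \<xi>" for n t \<xi>
      using that ivl_dist_ivl_delta_sum[OF that(1), of F \<xi> A] by (metis max_less_iff_conj)+
    have "\<exists>\<delta>>0. \<forall>n t \<xi>. fine_division T a b \<delta> n t \<and> tags_of T n t \<xi> \<longrightarrow>
        \<bar>delta_sum (\<lambda>s. lower (F s)) n t \<xi> - lower A\<bar> < \<epsilon>"
      "\<exists>\<delta>>0. \<forall>n t \<xi>. fine_division T a b \<delta> n t \<and> tags_of T n t \<xi> \<longrightarrow>
        \<bar>delta_sum (\<lambda>s. upper (F s)) n t \<xi> - upper A\<bar> < \<epsilon>"
      using \<delta> close by (intro exI[of _ \<delta>], simp)+
  }
  then show "?L \<and> ?U" unfolding has_delta_integral_def by simp
next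
  assume LU: "?L \<and> ?U"
  show ?IR
    unfolding has_IR_delta_integral_def
  proof (intro allI impI)
    fix \<epsilon> :: real assume "0 < \<epsilon>"
    obtain \<delta>1 where \<delta>1: "0 < \<delta>1" "\<And>n t \<xi>. fine_division T a b \<delta>1 n t \<Longrightarrow> tags_of T n t \<xi> \<Longrightarrow>
        \<bar>delta_sum (\<lambda>s. lower (F s)) n t \<xi> - lower A\<bar> < \<epsilon>"
      using LU[THEN conjunct1, unfolded has_delta_integral_def, rule_format, OF \<open>0 < \<epsilon>\<close>] by auto
    obtain \<delta>2 where \<delta>2: "0 < \<delta>2" "\<And>n t \<xi>. fine_division T a b \<delta>2 n t \<Longrightarrow> tags_of T n t \<xi> \<Longrightarrow>
        \<bar>delta_sum (\<lambda>s. upper (F s)) n t \<xi> - upper A\<bar> < \<epsilon>"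
      using LU[THEN conjunct2, unfolded has_delta_integral_def, rule_format, OF \<open>0 < \<epsilon>\<close>] by auto
    have "ivl_dist (ivl_delta_sum F n t \<xi>) A < \<epsilon>"
      if "fine_division T a b (min \<delta>1 \<delta>2) n t" "tags_of T n t \<xi>" for n t \<xi>
      unfolding ivl_dist_ivl_delta_sum[OF that(1)] max_less_iff_conj
      by (intro conjI \<delta>1(2) \<delta>2(2) fine_division_mono[OF that(1)] that(2)) simp_all
    then show "\<exists>\<delta>>0. \<forall>n t \<xi>. fine_division T a b \<delta> n t \<and> tags_of T n t \<xi> \<longrightarrow>
        ivl_dist (ivl_delta_sum F n t \<xi>) A < \<epsilon>"
      using \<delta>1(1) \<delta>2(1) by (intro exI[of _ "min \<delta>1 \<delta>2"]) simp
  qed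
qed

text \<open>Inclusion in \<open>f (\<alpha> x + (1 - \<alpha>) y)\<close> bounds its lower endpoint from above and its upper endpoint
  from below. Concavity of the upper endpoint is stated as convexity of its negative so that the
  results on convex functions serve both endpoints.\<close>

lemma convex_ivl_on_endpoints:
  assumes f: "convex_ivl_on {c<..<d} f"
  shows "convex_on {c<..<d} (\<lambda>x. lower (f x))" "convex_on {c<..<d} (\<lambda>x. - upper (f x))"
proof -
  have *: "lower (f ((1 - t) *\<^sub>R x + t *\<^sub>R y)) \<le> (1 - t) * lower (f x) + t * lower (f y)
    \<and> - upper (f ((1 - t) *\<^sub>R x + t *\<^sub>R y)) \<le> (1 - t) * - upper (f x) + t * - upper (f y)"
    if "0 < t" "t < 1" "x \<in> {c<..<d}" "y \<in> {c<..<d}" for t x y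
  proof -
    let ?S = "ivl_scale (1 - t) (f x) + ivl_scale (1 - (1 - t)) (f y)"
    have "set_of ?S \<subseteq> set_of (f ((1 - t) * x + (1 - (1 - t)) * y))"
      by (rule f[unfolded convex_ivl_on_def, rule_format]) (use that in auto)
    then have "lower (f ((1 - t) * x + t * y)) \<le> lower ?S" "upper ?S \<le> upper (f ((1 - t) * x + t * y))"
      using lower_le_upper[of ?S] by (auto simp: set_of_eq)
    then show ?thesis using that by (simp add: lower_ivl_scale upper_ivl_scale)
  qed
  show "convex_on {c<..<d} (\<lambda>x. lower (f x))" "convex_on {c<..<d} (\<lambda>x. - upper (f x))"
    by (rule convex_onI; use * in \<open>blast intro: convex_real_interval\<close>)+
qed

section \<open>Step extension of a time-scale function\<close>

text \<open>The last point of \<open>[a,b]\<^sub>T\<close> that is at most \<open>y\<close>. Inserting \<open>a\<close> makes the value \<open>a\<close> for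
  \<open>y < a\<close>, so that composition with \<open>ts_floor\<close> extends functions to the whole line.\<close>

definition ts_floor :: "real set \<Rightarrow> real \<Rightarrow> real \<Rightarrow> real \<Rightarrow> real" where
  "ts_floor T a b y = Sup (insert a {s \<in> ts_icc T a b. s \<le> y})"

context
  fixes T :: "real set" and a b :: real
  assumes closed_T: "closed T" and a_T: "a \<in> T" and b_T: "b \<in> T" and a_less_b: "a < b"
begin

lemma closed_ts_icc: "closed (ts_icc T a b)"
proof -
  have "ts_icc T a b = T \<inter> {a..b}" by (auto simp: ts_icc_def)
  then show ?thesis using closed_T by (simp add: closed_Int)
qed

lemma
  shows ts_floor_in: "ts_floor T a b y \<in> ts_icc T a b"
    and ts_floor_le: "a \<le> y \<Longrightarrow> ts_floor T a b y \<le> y"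
    and le_ts_floor: "s \<in> ts_icc T a b \<Longrightarrow> s \<le> y \<Longrightarrow> s \<le> ts_floor T a b y"
proof -
  let ?S = "insert a {s \<in> ts_icc T a b. s \<le> y}"
  have sub: "?S \<subseteq> ts_icc T a b"
    using a_T a_less_b by (auto simp: ts_icc_def)
  then have bdd: "bdd_above ?S"
    by (intro bdd_aboveI[of _ b]) (auto simp: ts_icc_def)
  have "{s \<in> ts_icc T a b. s \<le> y} = ts_icc T a b \<inter> {..y}" by auto
  then have "closed ?S"
    using closed_ts_icc by (simp add: closed_insert closed_Int)
  from closed_contains_Sup[OF _ bdd this] have mem: "ts_floor T a b y \<in> ?S"
    unfolding ts_floor_def by blast
  show "ts_floor T a b y \<in> ts_icc T a b" using mem sub by blast
  show "a \<le> y \<Longrightarrow> ts_floor T a b y \<le> y" using mem by auto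
  show "s \<in> ts_icc T a b \<Longrightarrow> s \<le> y \<Longrightarrow> s \<le> ts_floor T a b y"
    unfolding ts_floor_def by (rule cSup_upper[OF _ bdd]) simp
qed

lemma ts_floor_cong:
  assumes "\<And>s. s \<in> ts_icc T a b \<Longrightarrow> s \<le> x \<longleftrightarrow> s \<le> y"
  shows "ts_floor T a b x = ts_floor T a b y"
  unfolding ts_floor_def using assms by (intro arg_cong[of _ _ Sup]) auto

lemma ts_floor_id: "s \<in> ts_icc T a b \<Longrightarrow> ts_floor T a b s = s"
  using le_ts_floor[of s s] ts_floor_le[of s] by (simp add: ts_icc_def)

text \<open>Right density of \<open>x\<close> in \<open>T\<close> alone would not do at \<open>x = b\<close>, where limits are taken inside
  \<open>[a,b]\<^sub>T\<close>; accumulation of points of \<open>[a,b]\<^sub>T\<close> is the condition under which rd-continuity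
  has content.\<close>

lemma right_dense_if_accumulation:
  assumes acc: "\<And>r. 0 < r \<Longrightarrow> \<exists>k\<in>ts_icc T a b. x < k \<and> k < x + r"
  shows "x \<in> ts_icc T a b" "right_dense T x"
proof -
  have "\<exists>k\<in>ts_icc T a b. dist k x < e" if "0 < e" for e
    using acc[OF that] by (force simp: dist_real_def)
  then show "x \<in> ts_icc T a b"
    using closed_approachable[OF closed_ts_icc] by blast
  have ne: "\<exists>k\<in>T. x < k" using acc[of 1] by (auto simp: ts_icc_def)
  have "Inf {s \<in> T. s > x} = x"
  proof (rule antisym)
    show "Inf {s \<in> T. s > x} \<le> x"
    proof (rule field_le_epsilon)
      fix e :: real assume "0 < e"
      then obtain k where k: "k \<in> ts_icc T a b" "x < k" "k < x + e" using acc by blast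
      then have "Inf {s \<in> T. s > x} \<le> k"
        by (intro cInf_lower bdd_belowI[of _ x]) (auto simp: ts_icc_def)
      then show "Inf {s \<in> T. s > x} \<le> x + e" using k by simp
    qed
    show "x \<le> Inf {s \<in> T. s > x}" using ne by (intro cInf_greatest) auto
  qed
  then show "right_dense T x"
    using ne by (auto simp: right_dense_def forward_jump_def)
qed

lemma left_dense_if_accumulation:
  assumes acc: "\<And>r. 0 < r \<Longrightarrow> \<exists>k\<in>ts_icc T a b. x - r < k \<and> k < x"
  shows "x \<in> ts_icc T a b" "left_dense T x"
proof -
  have "\<exists>k\<in>ts_icc T a b. dist k x < e" if "0 < e" for e
    using acc[OF that] by (force simp: dist_real_def)
  then show "x \<in> ts_icc T a b"
    using closed_approachable[OF closed_ts_icc] by blast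
  have ne: "\<exists>k\<in>T. k < x" using acc[of 1] by (auto simp: ts_icc_def)
  have "Sup {s \<in> T. s < x} = x"
  proof (rule antisym)
    show "x \<le> Sup {s \<in> T. s < x}"
    proof (rule field_le_epsilon)
      fix e :: real assume "0 < e"
      then obtain k where k: "k \<in> ts_icc T a b" "x - e < k" "k < x" using acc by blast
      then have "k \<le> Sup {s \<in> T. s < x}"
        by (intro cSup_upper bdd_aboveI[of _ x]) (auto simp: ts_icc_def)
      then show "x \<le> Sup {s \<in> T. s < x} + e" using k by simp
    qed
    show "Sup {s \<in> T. s < x} \<le> x" using ne by (intro cSup_least) auto
  qed
  then show "left_dense T x"
    using ne by (auto simp: left_dense_def backward_jump_def)
qed

text \<open>On either side of \<open>x\<close>, if no points of \<open>[a,b]\<^sub>T\<close> accumulate at \<open>x\<close>, the extension is locally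
  constant on that side. Otherwise \<open>x\<close> is dense on that side and \<open>ts_floor T a b y\<close> is trapped
  between \<open>y\<close> and points of \<open>[a,b]\<^sub>T\<close> that tend to \<open>x\<close>, so the limit of \<open>F\<close> carries over.\<close>

lemma right_cont_left_lim_extension:
  assumes F: "F \<in> C_rd T a b X"
  shows "right_cont_left_lim (\<lambda>y. F (ts_floor T a b y))" (is "right_cont_left_lim ?G")
  unfolding right_cont_left_lim_def
proof (intro conjI allI)
  let ?K = "ts_icc T a b"
  fix x
  show "(?G \<longlongrightarrow> ?G x) (at_right x)"
  proof (cases "\<exists>r>0. \<forall>k\<in>?K. \<not> (x < k \<and> k < x + r)")
    case True
    then obtain r where r: "0 < r" "\<And>k. k \<in> ?K \<Longrightarrow> \<not> (x < k \<and> k < x + r)" by blast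
    have "?G y = ?G x" if "x < y" "y < x + r" for y
      using ts_floor_cong[of y x] r(2) that by fastforce
    then have "\<forall>\<^sub>F y in at_right x. ?G y = ?G x"
      unfolding eventually_at_right_field using r(1) by (intro exI[of _ "x + r"]) auto
    then show ?thesis by (rule tendsto_eventually)
  next
    case False
    then have acc: "\<And>r. 0 < r \<Longrightarrow> \<exists>k\<in>?K. x < k \<and> k < x + r" by blast
    note x = right_dense_if_accumulation[OF acc]
    have lim: "(F \<longlongrightarrow> F x) (at x within (?K \<inter> {x<..}))"
      using F x unfolding C_rd_def by blast
    show ?thesis
    proof (rule tendstoI)
      fix e :: real assume "0 < e"
      from tendstoD[OF lim this] obtain r where r: "0 < r"
        "\<And>k. k \<in> ?K \<Longrightarrow> x < k \<Longrightarrow> dist k x < r \<Longrightarrow> dist (F k) (F x) < e"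
        unfolding eventually_at by auto
      have "dist (?G y) (?G x) < e" if y: "x < y" "y < x + r" for y
      proof -
        have "x \<le> ts_floor T a b y" "ts_floor T a b y \<le> y"
          using le_ts_floor[of x y] ts_floor_le[of y] x(1) y by (auto simp: ts_icc_def)
        then show ?thesis
          using r(2)[OF ts_floor_in[of y]] y \<open>0 < e\<close>
          by (cases "ts_floor T a b y = x") (auto simp: ts_floor_id[OF x(1)] dist_real_def)
      qed
      then show "\<forall>\<^sub>F y in at_right x. dist (?G y) (?G x) < e"
        unfolding eventually_at_right_field using r(1) by (intro exI[of _ "x + r"]) auto
    qed
  qed
  show "\<exists>l. (?G \<longlongrightarrow> l) (at_left x)"
  proof (cases "\<exists>r>0. \<forall>k\<in>?K. \<not> (x - r < k \<and> k < x)")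
    case True
    then obtain r where r: "0 < r" "\<And>k. k \<in> ?K \<Longrightarrow> \<not> (x - r < k \<and> k < x)" by blast
    have "?G y = ?G (x - r)" if "x - r < y" "y < x" for y
      using ts_floor_cong[of y "x - r"] r(2) that by fastforce
    then have "\<forall>\<^sub>F y in at_left x. ?G y = ?G (x - r)"
      unfolding eventually_at_left_field using r(1) by (intro exI[of _ "x - r"]) auto
    then show ?thesis by (intro exI tendsto_eventually)
  next
    case False
    then have acc: "\<And>r. 0 < r \<Longrightarrow> \<exists>k\<in>?K. x - r < k \<and> k < x" by blast
    note x = left_dense_if_accumulation[OF acc]
    obtain l where lim: "(F \<longlongrightarrow> l) (at x within (?K \<inter> {..<x}))"
      using F x unfolding C_rd_def by blast
    have "(?G \<longlongrightarrow> l) (at_left x)"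
    proof (rule tendstoI)
      fix e :: real assume "0 < e"
      from tendstoD[OF lim this] obtain r where r: "0 < r"
        "\<And>k. k \<in> ?K \<Longrightarrow> k < x \<Longrightarrow> dist k x < r \<Longrightarrow> dist (F k) l < e"
        unfolding eventually_at by auto
      obtain k where k: "k \<in> ?K" "x - r < k" "k < x" using acc[OF r(1)] by blast
      have "dist (?G y) l < e" if y: "k < y" "y < x" for y
      proof -
        have "k \<le> ts_floor T a b y" "ts_floor T a b y \<le> y"
          using le_ts_floor[of k y] ts_floor_le[of y] k(1) y by (auto simp: ts_icc_def)
        then show ?thesis
          using y k by (intro r(2) ts_floor_in) (auto simp: dist_real_def)
      qed
      then show "\<forall>\<^sub>F y in at_left x. dist (?G y) l < e"
        unfolding eventually_at_left_field using k(3) by blast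
    qed
    then show ?thesis by blast
  qed
qed

section \<open>Existence of fine divisions\<close>

text \<open>Call \<open>q\<close> reachable if finitely many admissible steps lead from \<open>a\<close> to \<open>q\<close>. The supremum of the
  reachable points is reachable, since a step of length at most \<open>\<delta>\<close> leads to it. If it were less
  than \<open>b\<close>, then either some point would lie within \<open>\<delta>\<close> to its right or the next point of \<open>T\<close>
  would have it as backward jump, and both allow a further step.\<close>

lemma fine_division_exists:
  assumes "0 < \<delta>"
  obtains n t where "fine_division T a b \<delta> n t" "tags_of T n t (\<lambda>i. t (i - 1))"
proof -
  let ?K = "ts_icc T a b"
  define step where "step p q \<longleftrightarrow> p \<in> ?K \<and> q \<in> ?K \<and> p < q \<and> (q - p \<le> \<delta> \<or> backward_jump T q = p)" for p q
  have a_K: "a \<in> ?K" using a_T a_less_b by (simp add: ts_icc_def)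
  define S where "S = {q \<in> ?K. step\<^sup>*\<^sup>* a q}"
  have bdd: "bdd_above S" by (rule bdd_aboveI[of _ b]) (auto simp: S_def ts_icc_def)
  have ne: "S \<noteq> {}" using a_K by (auto simp: S_def)
  define s where "s = Sup S"
  have "closure S \<subseteq> ?K" by (rule closure_minimal) (auto simp: S_def closed_ts_icc)
  then have s_K: "s \<in> ?K"
    unfolding s_def using closure_contains_Sup[OF ne bdd] by blast
  have s_S: "s \<in> S"
  proof -
    have "s - \<delta> < Sup S" using \<open>0 < \<delta>\<close> by (simp add: s_def)
    then obtain q where q: "q \<in> S" "s - \<delta> < q" using less_cSupE[OF _ ne] by blast
    have "q \<le> s" unfolding s_def by (rule cSup_upper[OF q(1) bdd])
    show ?thesis
    proof (cases "q = s")
      case False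
      then have "step q s" using q \<open>q \<le> s\<close> s_K by (auto simp: step_def S_def)
      then show ?thesis using q s_K by (auto simp: S_def intro: rtranclp.rtrancl_into_rtrancl)
    qed (use q in simp)
  qed
  have no_step: "\<not> step s q" for q
  proof
    assume "step s q"
    then have "q \<in> S" using s_S by (auto simp: S_def step_def intro: rtranclp.rtrancl_into_rtrancl)
    then have "q \<le> s" unfolding s_def using bdd by (rule cSup_upper)
    then show False using \<open>step s q\<close> by (simp add: step_def)
  qed
  have "s = b"
  proof (rule ccontr)
    assume "s \<noteq> b"
    then have "s < b" using s_K by (simp add: ts_icc_def)
    \<comment> \<open>No step leads out of \<open>s\<close>, so \<open>?R\<close> consists of all points beyond \<open>s\<close>, and its least element has \<open>s\<close> as backward jump.\<close>
    let ?R = "?K \<inter> {s + \<delta>..}"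
    have far: "s + \<delta> \<le> q" if "q \<in> ?K" "s < q" for q
      using no_step[of q] that s_K by (auto simp: step_def)
    have ne': "?R \<noteq> {}" and bdd': "bdd_below ?R"
      using far[of b] \<open>s < b\<close> b_T a_less_b by (auto simp: ts_icc_def intro: bdd_belowI[of _ a])
    define q where "q = Inf ?R"
    have "q \<in> ?R"
      unfolding q_def using ne' bdd' closed_ts_icc by (intro closed_contains_Inf closed_Int) auto
    then have q: "q \<in> ?K" "s < q" using \<open>0 < \<delta>\<close> by auto
    have "backward_jump T q = s"
    proof (rule backward_jumpI)
      fix r assume r: "r \<in> T" "r < q"
      show "r \<le> s"
      proof (rule ccontr)
        assume "\<not> r \<le> s"
        then have "r \<in> ?K" using r q s_K by (auto simp: ts_icc_def)
        then have "r \<in> ?R" using far[of r] \<open>\<not> r \<le> s\<close> by auto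
        then have "q \<le> r" unfolding q_def using bdd' by (rule cInf_lower)
        then show False using r by simp
      qed
    qed (use s_K q in \<open>auto simp: ts_icc_def\<close>)
    then have "step s q" using q s_K by (simp add: step_def)
    then show False using no_step by blast
  qed
  then have "step\<^sup>*\<^sup>* a b" using s_S by (simp add: S_def)
  then obtain n t where t: "t 0 = a" "t n = b" "\<And>i. i < n \<Longrightarrow> step (t i) (t (Suc i))"
    by (metis rtranclp_imp_relpowp relpowp_fun_conv)
  have step: "step (t (i - 1)) (t i)" if "i \<in> {1..n}" for i
    using t(3)[of "i - 1"] that by auto
  have "t i \<in> ?K" if "i \<le> n" for i
    using step[of i] a_K t(1) that by (cases "i = 0") (auto simp: step_def)
  then have "fine_division T a b \<delta> n t"
    unfolding fine_division_def using step t(1,2) by (fastforce simp: step_def)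
  moreover have "tags_of T n t (\<lambda>i. t (i - 1))"
    unfolding tags_of_def using step by (force simp: step_def ts_ico_def ts_icc_def)
  ultimately show ?thesis using that by blast
qed

section \<open>Delta integrals as ordinary integrals\<close>

text \<open>The integral of the step extension \<open>G\<close> splits over the cells of the division, so the error is
  a sum of integrals of \<open>F (\<xi> i) - G\<close>. Take a step function within \<open>\<eta>\<close> of \<open>G\<close>, with finite jump
  set \<open>X\<close>. A cell longer than \<open>\<delta>\<close> is a gap of \<open>T\<close>, on which \<open>G\<close> is constant: no error. A cell
  without a point of \<open>X\<close> in its interior has error at most \<open>2 \<eta>\<close> times its length. Every other
  cell has error at most \<open>2 M \<delta>\<close>, where \<open>M\<close> bounds \<open>\<bar>G\<bar>\<close>, and there are at most \<open>card X\<close> of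
  these because the open cells are disjoint. The choices of \<open>\<eta>\<close> and \<open>\<delta>\<close> make the two
  contributions \<open>\<epsilon> / 2\<close> and less than \<open>\<epsilon> / 2\<close>.\<close>

lemma delta_sum_error:
  assumes F: "F \<in> C_rd T a b X" and "0 < \<epsilon>"
  shows "\<exists>\<delta>>0. \<forall>n t \<xi>. fine_division T a b \<delta> n t \<and> tags_of T n t \<xi> \<longrightarrow>
    \<bar>delta_sum F n t \<xi> - integral {a..b} (\<lambda>y. F (ts_floor T a b y))\<bar> < \<epsilon>"
proof -
  let ?G = "\<lambda>y. F (ts_floor T a b y)"
  let ?K = "ts_icc T a b"
  have G: "right_cont_left_lim ?G" by (rule right_cont_left_lim_extension[OF F])
  define \<eta> where "\<eta> = \<epsilon> / (4 * (b - a))"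
  have "0 < \<eta>" using \<open>0 < \<epsilon>\<close> a_less_b by (simp add: \<eta>_def)
  then obtain g X where g: "step_approx ?G \<eta> a b g X"
    using step_approx_exists[OF G less_imp_le[OF a_less_b]] by blast
  obtain M where M: "0 \<le> M" "\<And>y. y \<in> {a..b} \<Longrightarrow> \<bar>?G y\<bar> \<le> M"
    using right_cont_left_lim_bounded[OF G] by blast
  define \<delta> where "\<delta> = \<epsilon> / (4 * (M + 1) * (card X + 1))"
  have "0 < \<delta>" using M \<open>0 < \<epsilon>\<close> by (simp add: \<delta>_def)
  have "\<bar>delta_sum F n t \<xi> - integral {a..b} ?G\<bar> < \<epsilon>"
    if div: "fine_division T a b \<delta> n t" and tags: "tags_of T n t \<xi>" for n t \<xi>
  proof -
    define I where "I y = integral {a..y} ?G" for y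
    \<comment> \<open>Summing over \<open>X\<close> here lets the disjointness of the cells be used after exchanging the sums.\<close>
    define B where "B i = (\<Sum>x\<in>X. if t (i - 1) < x \<and> x < t i then 2 * M * \<delta> else 0)" for i
    have t: "t (i - 1) \<in> ?K" "t i \<in> ?K" "t (i - 1) < t i" if "i \<in> {1..n}" for i
      using div that by (auto simp: fine_division_def)
    have cell: "\<bar>F (\<xi> i) * (t i - t (i - 1)) - (I (t i) - I (t (i - 1)))\<bar>
        \<le> 2 * \<eta> * (t i - t (i - 1)) + B i" if i: "i \<in> {1..n}" for i
    proof -
      let ?p = "t (i - 1)" and ?q = "t i"
      note pq = t[OF i]
      have \<xi>: "\<xi> i \<in> ?K" "?p \<le> \<xi> i" "\<xi> i < ?q"
      proof -
        have "\<xi> i \<in> ts_ico T ?p ?q" using tags i unfolding tags_of_def by blast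
        then show "\<xi> i \<in> ?K" "?p \<le> \<xi> i" "\<xi> i < ?q"
          using pq unfolding ts_ico_def ts_icc_def by simp_all
      qed
      have G\<xi>: "?G (\<xi> i) = F (\<xi> i)" using \<xi>(1) by (simp add: ts_floor_id)
      have ab: "a \<le> ?p" "?q \<le> b" using pq by (auto simp: ts_icc_def)
      have intg: "?G integrable_on {u..v}" for u v by (rule right_cont_left_lim_integrable[OF G])
      have I_diff: "I ?p + integral {?p..?q} ?G = I ?q"
        unfolding I_def using ab pq
        by (intro Henstock_Kurzweil_Integration.integral_combine intg) auto
      have hI: "((\<lambda>y. F (\<xi> i) - ?G y) has_integral
          F (\<xi> i) * (?q - ?p) - (I ?q - I ?p)) (cbox ?p ?q)"
      proof -
        have "((\<lambda>_. F (\<xi> i)) has_integral F (\<xi> i) * (?q - ?p)) {?p..?q}"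
          using has_integral_const_real[of "F (\<xi> i)" ?p ?q] pq by (simp add: mult.commute)
        moreover have "integral {?p..?q} ?G = I ?q - I ?p" using I_diff by linarith
        then have "(?G has_integral (I ?q - I ?p)) {?p..?q}"
          using integrable_integral[OF intg[of ?p ?q]] by metis
        ultimately show ?thesis
          unfolding cbox_interval by (rule has_integral_diff)
      qed
      have bound: "\<bar>F (\<xi> i) * (?q - ?p) - (I ?q - I ?p)\<bar> \<le> C * (?q - ?p)"
        if "0 \<le> C" "\<And>y. ?p \<le> y \<Longrightarrow> y < ?q \<Longrightarrow> \<bar>F (\<xi> i) - ?G y\<bar> \<le> C" for C
        using has_integral_bound_spike_finite[OF that(1) _ hI, of "{?q}"] that(2) pq by auto
      have B0: "0 \<le> B i"
        unfolding B_def using M \<open>0 < \<delta>\<close> by (intro sum_nonneg) auto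
      have fine: "?q - ?p \<le> \<delta> \<or> backward_jump T ?q = ?p"
        using div i by (auto simp: fine_division_def)
      consider (gap) "backward_jump T ?q = ?p" | (good) "X \<inter> {?p<..<?q} = {}"
        | (bad) x where "x \<in> X" "?p < x" "x < ?q" "?q - ?p \<le> \<delta>"
        using fine by (metis disjoint_iff greaterThanLessThan_iff)
      then show ?thesis
      proof cases
        case gap
        have const: "s = ?p" if "s \<in> ?K" "?p \<le> s" "s < ?q" for s
          using backward_jumpD[OF gap pq(3), of s] that by (auto simp: ts_icc_def)
        have "\<bar>F (\<xi> i) - ?G y\<bar> \<le> 0" if "?p \<le> y" "y < ?q" for y
        proof -
          have "ts_floor T a b y = ?p"
            using ts_floor_le[of y] le_ts_floor[OF pq(1), of y] that ab
            by (intro const ts_floor_in) auto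
          moreover have "\<xi> i = ?p" using \<xi> by (rule const)
          ultimately show ?thesis by simp
        qed
        then have "\<bar>F (\<xi> i) * (?q - ?p) - (I ?q - I ?p)\<bar> \<le> 0 * (?q - ?p)"
          by (intro bound) auto
        moreover have "0 \<le> 2 * \<eta> * (?q - ?p)" using \<open>0 < \<eta>\<close> pq by simp
        ultimately show ?thesis using B0 by simp
      next
        case good
        have "\<bar>F (\<xi> i) - ?G y\<bar> \<le> 2 * \<eta>" if y: "?p \<le> y" "y < ?q" for y
        proof -
          have "g (\<xi> i) = g y"
          proof (cases "\<xi> i \<le> y")
            case True
            then show ?thesis using good \<xi> y ab by (intro step_approxD(5)[OF g]) auto
          next
            case False
            then have "g y = g (\<xi> i)"
              using good \<xi> y ab by (intro step_approxD(5)[OF g]) auto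
            then show ?thesis by simp
          qed
          moreover have "\<bar>?G y - g y\<bar> \<le> \<eta>" "\<bar>?G (\<xi> i) - g (\<xi> i)\<bar> \<le> \<eta>"
            using step_approxD(4)[OF g, of y] step_approxD(4)[OF g, of "\<xi> i"] y \<xi> ab by auto
          ultimately show ?thesis unfolding G\<xi> by linarith
        qed
        then have "\<bar>F (\<xi> i) * (?q - ?p) - (I ?q - I ?p)\<bar> \<le> 2 * \<eta> * (?q - ?p)"
          using \<open>0 < \<eta>\<close> by (intro bound) auto
        then show ?thesis using B0 by simp
      next
        case bad
        have "\<bar>F (\<xi> i) - ?G y\<bar> \<le> 2 * M" if "?p \<le> y" "y < ?q" for y
          using M(2)[of y] M(2)[of "\<xi> i"] that \<xi> ab unfolding G\<xi> by auto
        then have "\<bar>F (\<xi> i) * (?q - ?p) - (I ?q - I ?p)\<bar> \<le> 2 * M * (?q - ?p)"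
          using M(1) by (intro bound) auto
        also have "\<dots> \<le> 2 * M * \<delta>" using M(1) bad by (intro mult_left_mono) auto
        also have "\<dots> = (if ?p < x \<and> x < ?q then 2 * M * \<delta> else 0)" using bad by simp
        also have "\<dots> \<le> B i"
          unfolding B_def using bad(1) step_approxD(1)[OF g] M \<open>0 < \<delta>\<close>
          by (intro member_le_sum) auto
        moreover have "0 \<le> 2 * \<eta> * (?q - ?p)" using \<open>0 < \<eta>\<close> pq by simp
        ultimately show ?thesis by linarith
      qed
    qed
    have mono: "t i \<le> t j" if "i \<le> j" "j \<le> n" for i j
      using that
    proof (induction j rule: dec_induct)
      case (step j)
      then show ?case using t(3)[of "Suc j"] by auto
    qed simp
    have B_sum: "(\<Sum>i=1..n. B i) \<le> card X * (2 * M * \<delta>)"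
    proof -
      have "(\<Sum>i=1..n. if t (i - 1) < x \<and> x < t i then 2 * M * \<delta> else 0) \<le> 2 * M * \<delta>" for x
      proof -
        let ?J = "{i \<in> {1..n}. t (i - 1) < x \<and> x < t i}"
        \<comment> \<open>A point lies in the interior of at most one cell.\<close>
        have not_lt: "\<not> i < j" if "i \<in> ?J" "j \<in> ?J" for i j
        proof
          assume "i < j"
          then have "t i \<le> t (j - 1)" using that by (intro mono) auto
          moreover have "x < t i" "t (j - 1) < x" using that by auto
          ultimately show False by linarith
        qed
        have "\<forall>i\<in>?J. \<forall>j\<in>?J. i = j"
        proof (intro ballI)
          fix i j assume ij: "i \<in> ?J" "j \<in> ?J"
          show "i = j"
            using not_lt[OF ij] not_lt[OF ij(2,1)] by linarith
        qed
        then have "card ?J \<le> 1"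
          using card_le_Suc0_iff_eq[of ?J] by simp
        have "(\<Sum>i=1..n. if t (i - 1) < x \<and> x < t i then 2 * M * \<delta> else 0) = card ?J * (2 * M * \<delta>)"
          by (simp add: sum.If_cases Int_def)
        also have "\<dots> \<le> 1 * (2 * M * \<delta>)"
          using \<open>card ?J \<le> 1\<close> M \<open>0 < \<delta>\<close> by (intro mult_right_mono) auto
        finally show ?thesis by simp
      qed
      then have "(\<Sum>x\<in>X. \<Sum>i=1..n. if t (i - 1) < x \<and> x < t i then 2 * M * \<delta> else 0)
          \<le> (\<Sum>x\<in>X. 2 * M * \<delta>)"
        by (intro sum_mono)
      then show ?thesis unfolding B_def by (subst sum.swap) simp
    qed
    have tel: "(\<Sum>i=1..n. \<phi> (t i) - \<phi> (t (i - 1))) = \<phi> b - \<phi> a" for \<phi> :: "real \<Rightarrow> real"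
      using sum_telescope''[of 0 n "\<lambda>i. \<phi> (t i)"] div by (simp add: fine_division_def)
    have "\<bar>delta_sum F n t \<xi> - (I b - I a)\<bar>
        = \<bar>\<Sum>i=1..n. F (\<xi> i) * (t i - t (i - 1)) - (I (t i) - I (t (i - 1)))\<bar>"
      by (simp only: tel[of I, symmetric] delta_sum_def sum_subtractf)
    also have "\<dots> \<le> (\<Sum>i=1..n. 2 * \<eta> * (t i - t (i - 1)) + B i)"
      by (rule order_trans[OF sum_abs sum_mono[OF cell]])
    also have "\<dots> = 2 * \<eta> * (b - a) + (\<Sum>i=1..n. B i)"
      using tel[of "\<lambda>x. x"] by (simp add: sum.distrib sum_distrib_left[symmetric])
    also have "\<dots> \<le> 2 * \<eta> * (b - a) + card X * (2 * M * \<delta>)" using B_sum by simp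
    also have "\<dots> < \<epsilon>"
    proof -
      have "2 * \<eta> * (b - a) = \<epsilon> / 2" using a_less_b by (simp add: \<eta>_def field_simps)
      moreover have "card X * (2 * M * \<delta>) < \<epsilon> / 2"
      proof -
        have "card X * M < (M + 1) * (card X + 1)" using M(1) by (simp add: algebra_simps add_nonneg_pos)
        then have "card X * M / ((M + 1) * (card X + 1)) < 1" using M(1) by (simp add: divide_less_eq_1)
        then have "\<epsilon> / 2 * (card X * M / ((M + 1) * (card X + 1))) < \<epsilon> / 2 * 1"
          using \<open>0 < \<epsilon>\<close> by (intro mult_strict_left_mono) auto
        moreover have "card X * (2 * M * \<delta>) = \<epsilon> / 2 * (card X * M / ((M + 1) * (card X + 1)))"
        proof -
          have "\<delta> = \<epsilon> / (4 * ((M + 1) * (card X + 1)))" by (simp add: \<delta>_def mult.assoc)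
          then show ?thesis by simp
        qed
        ultimately show ?thesis by simp
      qed
      ultimately show ?thesis by simp
    qed
    finally show ?thesis by (simp add: I_def)
  qed
  then show ?thesis using \<open>0 < \<delta>\<close> by blast
qed

lemma has_delta_integral_extension:
  assumes "F \<in> C_rd T a b X"
  shows "has_delta_integral T a b F (integral {a..b} (\<lambda>y. F (ts_floor T a b y)))"
  unfolding has_delta_integral_def using delta_sum_error[OF assms] by blast

lemma has_delta_integral_unique:
  assumes "has_delta_integral T a b F A" "has_delta_integral T a b F B"
  shows "A = B"
proof -
  have "\<bar>A - B\<bar> \<le> 0 + e" if "0 < e" for e
  proof -
    have "0 < e / 2" using that by simp
    obtain \<delta>1 where \<delta>1: "0 < \<delta>1" "\<And>n t \<xi>. fine_division T a b \<delta>1 n t \<Longrightarrow> tags_of T n t \<xi> \<Longrightarrow>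
        \<bar>delta_sum F n t \<xi> - A\<bar> < e / 2"
      using assms(1)[unfolded has_delta_integral_def, rule_format, OF \<open>0 < e / 2\<close>] by auto
    obtain \<delta>2 where \<delta>2: "0 < \<delta>2" "\<And>n t \<xi>. fine_division T a b \<delta>2 n t \<Longrightarrow> tags_of T n t \<xi> \<Longrightarrow>
        \<bar>delta_sum F n t \<xi> - B\<bar> < e / 2"
      using assms(2)[unfolded has_delta_integral_def, rule_format, OF \<open>0 < e / 2\<close>] by auto
    obtain n t where nt: "fine_division T a b (min \<delta>1 \<delta>2) n t" "tags_of T n t (\<lambda>i. t (i - 1))"
      using fine_division_exists[of "min \<delta>1 \<delta>2"] \<delta>1 \<delta>2 by auto
    have "\<bar>delta_sum F n t (\<lambda>i. t (i - 1)) - A\<bar> < e / 2"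
      by (rule \<delta>1(2)[OF fine_division_mono[OF nt(1)] nt(2)]) simp
    moreover have "\<bar>delta_sum F n t (\<lambda>i. t (i - 1)) - B\<bar> < e / 2"
      by (rule \<delta>2(2)[OF fine_division_mono[OF nt(1)] nt(2)]) simp
    ultimately show ?thesis by arith
  qed
  then have "\<bar>A - B\<bar> \<le> 0" by (rule field_le_epsilon)
  then show ?thesis by simp
qed

lemma delta_integral_eqI: "has_delta_integral T a b F A \<Longrightarrow> delta_integral T a b F = A"
  unfolding delta_integral_def using has_delta_integral_unique by blast

section \<open>Jensen's inequality\<close>

text \<open>The bridge along which facts about ordinary integrals reach delta integrals.\<close>

lemma extension_has_integral:
  assumes "F \<in> C_rd T a b X"
  shows "((\<lambda>y. F (ts_floor T a b y)) has_integral delta_integral T a b F) {a..b}"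
proof -
  have "(\<lambda>y. F (ts_floor T a b y)) integrable_on {a..b}"
    by (intro right_cont_left_lim_integrable
      right_cont_left_lim_extension[OF assms])
  moreover have "delta_integral T a b F = integral {a..b} (\<lambda>y. F (ts_floor T a b y))"
    by (rule delta_integral_eqI[OF has_delta_integral_extension[OF assms]])
  ultimately show ?thesis by (simp add: has_integral_iff)
qed

lemma has_delta_integral_delta_integral:
  assumes "F \<in> C_rd T a b X"
  shows "has_delta_integral T a b F (delta_integral T a b F)"
  using has_delta_integral_extension[OF assms]
    delta_integral_eqI by metis

lemma delta_integral_weighted_affine:
  assumes w: "w \<in> C_rd T a b X" and g: "g \<in> C_rd T a b Y"
  shows "delta_integral T a b (\<lambda>s. w s * (p + q * g s)) =
    p * delta_integral T a b w + q * delta_integral T a b (\<lambda>s. w s * g s)"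
proof (rule has_integral_unique[OF extension_has_integral])
  show "(\<lambda>s. w s * (p + q * g s)) \<in> C_rd T a b UNIV"
    by (rule C_rd_mult[OF w C_rd_affine[OF g]])
  show "((\<lambda>y. w (ts_floor T a b y) * (p + q * g (ts_floor T a b y))) has_integral
    p * delta_integral T a b w + q * delta_integral T a b (\<lambda>s. w s * g s)) {a..b}"
    using has_integral_add[OF has_integral_mult_right[OF extension_has_integral[OF w], of p]
      has_integral_mult_right[OF extension_has_integral[OF C_rd_mult[OF w g]], of q]]
    by (simp add: algebra_simps)
qed

text \<open>Since the integral of \<open>w\<close> is not zero, its extension is nonzero at some \<open>y < b\<close>, and there the
  product with \<open>u\<close> is positive.\<close>

lemma weighted_delta_integral_pos:
  assumes w: "w \<in> C_rd T a b X" and w_nonneg: "\<And>s. 0 \<le> w s" and w_pos: "0 < delta_integral T a b w"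
    and u: "u \<in> C_rd T a b Y" and u_pos: "\<And>s. s \<in> ts_icc T a b \<Longrightarrow> 0 < u s"
  shows "0 < delta_integral T a b (\<lambda>s. w s * u s)"
proof -
  let ?\<tau> = "ts_floor T a b"
  have \<tau>: "?\<tau> y \<in> ts_icc T a b" for y
    by (rule ts_floor_in)
  have wu: "(\<lambda>s. w s * u s) \<in> C_rd T a b UNIV" by (rule C_rd_mult[OF w u])
  obtain y where y: "a \<le> y" "y < b" "w (?\<tau> y) \<noteq> 0"
  proof (rule ccontr)
    assume "\<not> thesis"
    then have zero: "w (?\<tau> y) = 0" if "y \<in> {a..b} - {b}" for y
      using that \<open>\<And>y. a \<le> y \<Longrightarrow> y < b \<Longrightarrow> w (?\<tau> y) \<noteq> 0 \<Longrightarrow> thesis\<close> by force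
    have "((\<lambda>y. w (?\<tau> y)) has_integral 0) {a..b}"
      by (rule has_integral_spike_finite[of "{b}", OF _ zero has_integral_0]) auto
    then have "delta_integral T a b w = 0"
      using has_integral_unique[OF extension_has_integral[OF w]] by blast
    then show False using w_pos by simp
  qed
  have "0 < integral {a..b} (\<lambda>y. w (?\<tau> y) * u (?\<tau> y))"
  proof (rule integral_pos_if_right_cont[OF _ _ y(1,2)])
    show "right_cont_left_lim (\<lambda>y. w (?\<tau> y) * u (?\<tau> y))"
      by (rule right_cont_left_lim_extension[OF wu])
    show "0 \<le> w (?\<tau> y) * u (?\<tau> y)" for y
      using w_nonneg[of "?\<tau> y"] u_pos[OF \<tau>, of y] by simp
    show "0 < w (?\<tau> y) * u (?\<tau> y)"
      using w_nonneg[of "?\<tau> y"] u_pos[OF \<tau>, of y] y(3) by (simp add: less_le)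
  qed
  then show ?thesis
    using extension_has_integral[OF wu] by (simp add: has_integral_iff)
qed

text \<open>The integrals of \<open>w (g - c)\<close> and \<open>w (d - g)\<close> are positive.\<close>

lemma weighted_mean_in_interval:
  assumes w: "w \<in> C_rd T a b X" and w_nonneg: "\<And>s. 0 \<le> w s" and w_pos: "0 < delta_integral T a b w"
    and g: "g \<in> C_rd T a b {c<..<d}"
  shows "delta_integral T a b (\<lambda>s. w s * g s) / delta_integral T a b w \<in> {c<..<d}"
proof -
  have g_in: "c < g s" "g s < d" if "s \<in> ts_icc T a b" for s
    using g that unfolding C_rd_def by auto
  have "0 < delta_integral T a b (\<lambda>s. w s * (- c + 1 * g s))"
    by (rule weighted_delta_integral_pos[OF w w_nonneg w_pos C_rd_affine[OF g]]) (use g_in in auto)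
  moreover have "0 < delta_integral T a b (\<lambda>s. w s * (d + (- 1) * g s))"
    by (rule weighted_delta_integral_pos[OF w w_nonneg w_pos C_rd_affine[OF g]]) (use g_in in auto)
  ultimately show ?thesis
    using w_pos unfolding delta_integral_weighted_affine[OF w g]
    by (simp add: field_simps)
qed

text \<open>The line through \<open>(m, \<phi> m)\<close> that supports \<open>\<phi>\<close> exists because the mean \<open>m\<close> is interior; its
  weighted integral is \<open>\<phi> m\<close> times the integral of \<open>w\<close>, since \<open>g - m\<close> has weighted integral 0.\<close>

lemma delta_integral_jensen:
  fixes \<phi> :: "real \<Rightarrow> real"
  assumes \<phi>: "convex_on {c<..<d} \<phi>"
    and w: "w \<in> C_rd T a b X" and w_nonneg: "\<And>s. 0 \<le> w s" and w_pos: "0 < delta_integral T a b w"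
    and g: "g \<in> C_rd T a b {c<..<d}" and \<phi>g: "(\<lambda>s. \<phi> (g s)) \<in> C_rd T a b UNIV"
  shows "\<phi> (delta_integral T a b (\<lambda>s. w s * g s) / delta_integral T a b w)
    \<le> delta_integral T a b (\<lambda>s. w s * \<phi> (g s)) / delta_integral T a b w"
proof -
  define m where "m = delta_integral T a b (\<lambda>s. w s * g s) / delta_integral T a b w"
  have m: "m \<in> {c<..<d}"
    unfolding m_def by (rule weighted_mean_in_interval[OF w w_nonneg w_pos g])
  obtain k where k: "\<And>x. x \<in> {c<..<d} \<Longrightarrow> \<phi> m + k * (x - m) \<le> \<phi> x"
    using convex_le_Inf_differential[OF \<phi>, of m] m by (simp add: interior_open) blast
  have "delta_integral T a b (\<lambda>s. w s * ((\<phi> m - k * m) + k * g s))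
      \<le> delta_integral T a b (\<lambda>s. w s * \<phi> (g s))"
  proof (rule has_integral_le[OF extension_has_integral extension_has_integral])
    show "(\<lambda>s. w s * ((\<phi> m - k * m) + k * g s)) \<in> C_rd T a b UNIV"
      by (rule C_rd_mult[OF w C_rd_affine[OF g]])
    show "(\<lambda>s. w s * \<phi> (g s)) \<in> C_rd T a b UNIV"
      by (rule C_rd_mult[OF w \<phi>g])
    fix y
    let ?s = "ts_floor T a b y"
    have "g ?s \<in> {c<..<d}"
      using g ts_floor_in[of y] unfolding C_rd_def by blast
    from k[OF this] show "w ?s * ((\<phi> m - k * m) + k * g ?s) \<le> w ?s * \<phi> (g ?s)"
      by (intro mult_left_mono w_nonneg) (simp add: algebra_simps)
  qed
  moreover have "delta_integral T a b (\<lambda>s. w s * g s) = m * delta_integral T a b w"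
    using w_pos by (simp add: m_def)
  ultimately have "\<phi> m * delta_integral T a b w \<le> delta_integral T a b (\<lambda>s. w s * \<phi> (g s))"
    unfolding delta_integral_weighted_affine[OF w g] by (simp add: algebra_simps)
  then show ?thesis
    using w_pos by (simp add: m_def[symmetric] le_divide_eq)
qed

end

theorem theorem9:
  fixes T :: "real set" and a b c d :: real
    and g h :: "real \<Rightarrow> real" and f :: "real \<Rightarrow> real interval"
  assumes "time_scale T" and "a \<in> T" and "b \<in> T" and "a < b" and "c < d"
    and "g \<in> C_rd T a b {c<..<d}"
    and "h \<in> C_rd T a b UNIV"
    and "delta_integral T a b (\<lambda>s. \<bar>h s\<bar>) > 0"
    and "f \<in> C_ivl {c<..<d} pos_intervals"
    and "convex_ivl_on {c<..<d} f"
  shows "delta_integrable T a b (\<lambda>s. \<bar>h s\<bar>)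
    \<and> delta_integrable T a b (\<lambda>s. \<bar>h s\<bar> * g s)
    \<and> IR_delta_integrable T a b (\<lambda>s. ivl_scale \<bar>h s\<bar> (f (g s)))
    \<and> delta_integral T a b (\<lambda>s. \<bar>h s\<bar> * g s) / delta_integral T a b (\<lambda>s. \<bar>h s\<bar>) \<in> {c<..<d}
    \<and> set_of (ivl_scale (1 / delta_integral T a b (\<lambda>s. \<bar>h s\<bar>))
                (IR_delta_integral T a b (\<lambda>s. ivl_scale \<bar>h s\<bar> (f (g s)))))
      \<subseteq> set_of (f (delta_integral T a b (\<lambda>s. \<bar>h s\<bar> * g s) / delta_integral T a b (\<lambda>s. \<bar>h s\<bar>)))"
proof -
  note g = assms(6) and Hpos = assms(8)
  let ?w = "\<lambda>s. \<bar>h s\<bar>"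
  let ?H = "delta_integral T a b ?w"
  let ?m = "delta_integral T a b (\<lambda>s. ?w s * g s) / ?H"
  let ?F = "\<lambda>s. ivl_scale \<bar>h s\<bar> (f (g s))"
  have closed: "closed T" using assms(1) by (simp add: time_scale_def)
  note ctx = closed assms(2-4)
  have w: "?w \<in> C_rd T a b UNIV" by (rule C_rd_abs[OF assms(7)])
  have pos: "0 < lower (f x)" if "x \<in> {c<..<d}" for x
    using assms(9) that by (auto simp: C_ivl_def pos_intervals_def)
  note conv = convex_ivl_on_endpoints[OF assms(10)]
  have ev_c: "\<forall>\<^sub>F x in at_right c. x \<in> {c<..<d}"
    using \<open>c < d\<close> unfolding eventually_at_right_field by auto
  have ev_d: "\<forall>\<^sub>F x in at_left d. x \<in> {c<..<d}"
    using \<open>c < d\<close> unfolding eventually_at_left_field by auto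
  have upper_le: "- upper (f x) \<le> 0" if "x \<in> {c<..<d}" for x
    using pos[OF that] lower_le_upper[of "f x"] by linarith
  \<comment> \<open>The upper endpoint comes first: its limits at \<open>c\<close> and \<open>d\<close> bound the lower endpoint there.\<close>
  have upper_c: "\<forall>\<^sub>F x in at_right c. - upper (f x) \<le> 0"
    using ev_c by (rule eventually_mono) (rule upper_le)
  obtain uc where uc: "((\<lambda>x. - upper (f x)) \<longlongrightarrow> uc) (at_right c)"
    using convex_on_tendsto_at_right[OF conv(2) \<open>c < d\<close> upper_c] by (rule exE)
  have upper_d: "\<forall>\<^sub>F x in at_left d. - upper (f x) \<le> 0"
    using ev_d by (rule eventually_mono) (rule upper_le)
  obtain ud where ud: "((\<lambda>x. - upper (f x)) \<longlongrightarrow> ud) (at_left d)"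
    using convex_on_tendsto_at_left[OF conv(2) \<open>c < d\<close> upper_d] by (rule exE)
  have lower_bound: "lower (f x) \<le> 1 - u" if "u - 1 < - upper (f x)" for x u
    using that lower_le_upper[of "f x"] by linarith
  have "\<forall>\<^sub>F x in at_right c. uc - 1 < - upper (f x)" by (rule order_tendstoD(1)[OF uc]) simp
  then have "\<forall>\<^sub>F x in at_right c. lower (f x) \<le> 1 - uc"
    by (rule eventually_mono) (rule lower_bound)
  then have lc: "\<exists>l. ((\<lambda>x. lower (f x)) \<longlongrightarrow> l) (at_right c)"
    by (rule convex_on_tendsto_at_right[OF conv(1) \<open>c < d\<close>])
  have "\<forall>\<^sub>F x in at_left d. ud - 1 < - upper (f x)" by (rule order_tendstoD(1)[OF ud]) simp
  then have "\<forall>\<^sub>F x in at_left d. lower (f x) \<le> 1 - ud"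
    by (rule eventually_mono) (rule lower_bound)
  then have ld: "\<exists>l. ((\<lambda>x. lower (f x)) \<longlongrightarrow> l) (at_left d)"
    by (rule convex_on_tendsto_at_left[OF conv(1) \<open>c < d\<close>])
  have lg: "(\<lambda>s. lower (f (g s))) \<in> C_rd T a b UNIV"
    by (rule C_rd_compose[OF g convex_on_continuous[OF _ conv(1)] lc ld]) simp
  have ug: "(\<lambda>s. - upper (f (g s))) \<in> C_rd T a b UNIV"
    by (rule C_rd_compose[OF g convex_on_continuous[OF _ conv(2)]]) (use uc ud in auto)
  define L where "L = delta_integral T a b (\<lambda>s. ?w s * lower (f (g s)))"
  define U where "U = - delta_integral T a b (\<lambda>s. ?w s * - upper (f (g s)))"
  have m: "?m \<in> {c<..<d}"
    by (rule weighted_mean_in_interval[OF ctx w _ Hpos g]) simp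
  have jl: "lower (f ?m) \<le> L / ?H"
    unfolding L_def by (rule delta_integral_jensen[OF ctx conv(1) w _ Hpos g lg]) simp
  have "- upper (f ?m) \<le> - U / ?H"
    unfolding U_def minus_minus by (rule delta_integral_jensen[OF ctx conv(2) w _ Hpos g ug]) simp
  then have ju: "U / ?H \<le> upper (f ?m)" by simp
  have hL: "has_delta_integral T a b (\<lambda>s. lower (?F s)) L"
    using has_delta_integral_delta_integral[OF ctx C_rd_mult[OF w lg]]
    by (simp add: L_def lower_ivl_scale)
  have wu: "(\<lambda>s. ?w s * upper (f (g s))) \<in> C_rd T a b UNIV"
    using C_rd_mult[OF w C_rd_affine[OF ug, of 0 "-1"]] by simp
  have U_eq: "delta_integral T a b (\<lambda>s. ?w s * upper (f (g s))) = U"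
    using delta_integral_weighted_affine[OF ctx w ug, of 0 "-1"] by (simp add: U_def)
  then have hU: "has_delta_integral T a b (\<lambda>s. upper (?F s)) U"
    using has_delta_integral_delta_integral[OF ctx wu] by (simp add: upper_ivl_scale)
  have "L \<le> U"
    unfolding L_def
  proof (rule has_integral_le[OF extension_has_integral[OF ctx C_rd_mult[OF w lg]]])
    show "((\<lambda>y. ?w (ts_floor T a b y) * upper (f (g (ts_floor T a b y)))) has_integral U) {a..b}"
      using extension_has_integral[OF ctx wu] U_eq by simp
  qed (simp add: mult_left_mono)
  define A where "A = Interval (L, U)"
  have A: "lower A = L" "upper A = U"
    using \<open>L \<le> U\<close> by (simp_all add: A_def lower.rep_eq upper.rep_eq Interval_inverse)
  have hA: "has_IR_delta_integral T a b ?F A"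
    unfolding has_IR_delta_integral_iff A using hL hU by blast
  have "IR_delta_integral T a b ?F = A"
    unfolding IR_delta_integral_def
  proof (rule the_equality)
    show "has_IR_delta_integral T a b ?F A" by (rule hA)
    fix B assume "has_IR_delta_integral T a b ?F B"
    then show "B = A"
      unfolding has_IR_delta_integral_iff interval_eq_iff A
      using has_delta_integral_unique[OF ctx _ hL] has_delta_integral_unique[OF ctx _ hU] by blast
  qed
  then have "set_of (ivl_scale (1 / ?H) (IR_delta_integral T a b ?F)) \<subseteq> set_of (f ?m)"
    using jl ju Hpos by (simp add: set_of_eq lower_ivl_scale upper_ivl_scale A)
  then show ?thesis
    using m hA has_delta_integral_delta_integral[OF ctx w]
      has_delta_integral_delta_integral[OF ctx C_rd_mult[OF w g]]
    unfolding delta_integrable_def IR_delta_integrable_def by blast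
qed

end
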